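(* Let $N_{\rm RF},N_u\ge 1$ be integers, $p_u>0$, $c>0$, $f_s>0$, $\bar b>0$, and let ${\bf H}_{\rm b}\in\mathbb{C}^{N_{\rm RF}\times N_u}$ have rows $[{\bf H}_{\rm b}]_{i,:}$. Put ${\rm SNR}_i^{\rm rf}=p_u\|[{\bf H}_{\rm b}]_{i,:}\|^2$ and $\sigma_{y_i}^2={\rm SNR}_i^{\rm rf}+1$ for $i=1,\dots,N_{\rm RF}$. Consider the relaxed minimum mean square quantization error problem $$\hat{\mathbf b}=\arg\min_{\mathbf b=[b_1,\dots,b_{N_{\rm RF}}]^{\top}\in\mathbb{R}^{N_{\rm RF}}}\ \sum_{i=1}^{N_{\rm RF}}\mathcal{E}_{y_i}(b_i)\quad\text{subject to}\quad \sum_{i=1}^{N_{\rm RF}}P_{\rm ADC}(b_i)\le N_{\rm RF}\,P_{\rm ADC}(\bar b),$$ where, for all $b\in\mathbb{R}$, $\mathcal{E}_{y_i}(b)=\frac{\pi\sqrt3}{2}\,\sigma_{y_i}^2\,2^{-2b}$ and $P_{\rm ADC}(b)=c\,f_s\,2^{b}$. Then the optimal solution of this problem is $$\hat b_i=\bar b+\log_2\left(\frac{N_{\rm RF}\big(1+{\rm SNR}_i^{\rm rf}\big)^{1/3}}{\sum_{j=1}^{N_{\rm RF}}\big(1+{\rm SNR}_j^{\rm rf}\big)^{1/3}}\right),\qquad i=1,\dots,N_{\rm RF}.$$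
   Context: $\|\cdot\|$ is the Euclidean norm. The setting is a receiver with $N_{\rm RF}$ RF chains, where the $i$-th chain's analog-to-digital converter (ADC) pair uses $b_i$ bits (relaxed to real numbers); $\mathcal{E}_{y_i}$ models the mean square quantization error of the $i$-th received signal, $P_{\rm ADC}$ models the ADC power consumption, and $\bar b$ is a reference number of bits fixing the total power budget. *)

theory Defs
  imports "HOL-Analysis.Analysis"
begin

(* The index type 'n ranges over the N_RF RF chains and 'u over the N_u users, so that
   N_RF = CARD('n) and N_u = CARD('u).  Rows of H are vectors of type complex^'u, whose norm
   is the Euclidean one. *)

definition snr_rf :: "real \<Rightarrow> complex^'u^'n \<Rightarrow> 'n \<Rightarrow> real" where
  "snr_rf pu H i = pu * (norm (row i H))\<^sup>2"

definition signal_variance :: "real \<Rightarrow> complex^'u^'n \<Rightarrow> 'n \<Rightarrow> real" where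
  "signal_variance pu H i = snr_rf pu H i + 1"

definition quant_error :: "real \<Rightarrow> complex^'u^'n \<Rightarrow> 'n \<Rightarrow> real \<Rightarrow> real" where
  "quant_error pu H i b = pi * sqrt 3 / 2 * signal_variance pu H i * 2 powr (- 2 * b)"

definition adc_power :: "real \<Rightarrow> real \<Rightarrow> real \<Rightarrow> real" where
  "adc_power c fs b = c * fs * 2 powr b"

definition total_quant_error :: "real \<Rightarrow> complex^'u^'n \<Rightarrow> real^'n \<Rightarrow> real" where
  "total_quant_error pu H b = (\<Sum>i\<in>UNIV. quant_error pu H i (b $ i))"

definition power_feasible :: "real \<Rightarrow> real \<Rightarrow> real \<Rightarrow> real^'n \<Rightarrow> bool" where
  "power_feasible c fs bbar b \<longleftrightarrow>
     (\<Sum>i\<in>UNIV. adc_power c fs (b $ i)) \<le> real CARD('n) * adc_power c fs bbar"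

end

theory Submission
  imports Defs
begin

text \<open>In the variables \<open>x\<^sub>i = 2\<^bsup>b\<^sub>i\<^esup>\<close> the power constraint is linear and the objective is a
  positive multiple of \<open>\<Sum>\<^sub>i s\<^sub>i\<^sup>3 / x\<^sub>i\<^sup>2\<close> with \<open>s\<^sub>i = (1 + SNR\<^sub>i)\<^bsup>1/3\<^esup>\<close>. Each summand is strictly
  convex, so it lies above its tangent at \<open>x\<^sub>i = l s\<^sub>i\<close>. The slope \<open>- 2 / l\<^sup>3\<close> of this tangent does
  not depend on \<open>i\<close>, so for the value of \<open>l\<close> that exhausts the power budget the tangents sum to
  the asserted minimum on the whole feasible set, and equality forces \<open>x\<^sub>i = l s\<^sub>i\<close> for all \<open>i\<close>.\<close>

lemma inverse_square_tangent:
  fixes s l x :: real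
  assumes "s > 0" "l > 0" "x > 0"
  shows "s ^ 3 / x\<^sup>2 \<ge> 3 * s / l\<^sup>2 - 2 * x / l ^ 3"
    and "x \<noteq> l * s \<Longrightarrow> s ^ 3 / x\<^sup>2 > 3 * s / l\<^sup>2 - 2 * x / l ^ 3"
proof -
  \<comment> \<open>Tangency at \<open>x = l * s\<close> forces a double root of the gap there; the
    cofactor is positive for \<open>x > 0\<close>.\<close>
  have gap: "s ^ 3 / x\<^sup>2 - (3 * s / l\<^sup>2 - 2 * x / l ^ 3) =
      (x - l * s)\<^sup>2 * (2 * x + l * s) / (l ^ 3 * x\<^sup>2)"
    using assms by (simp add: field_simps power2_eq_square power3_eq_cube)
  have pos: "2 * x + l * s > 0" "l ^ 3 * x\<^sup>2 > 0"
    using assms by (simp_all add: add_pos_pos)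
  then have "(x - l * s)\<^sup>2 * (2 * x + l * s) / (l ^ 3 * x\<^sup>2) \<ge> 0"
    by simp
  with gap show "s ^ 3 / x\<^sup>2 \<ge> 3 * s / l\<^sup>2 - 2 * x / l ^ 3"
    by linarith
  assume "x \<noteq> l * s"
  with pos have "(x - l * s)\<^sup>2 * (2 * x + l * s) / (l ^ 3 * x\<^sup>2) > 0"
    by simp
  with gap show "s ^ 3 / x\<^sup>2 > 3 * s / l\<^sup>2 - 2 * x / l ^ 3"
    by linarith
qed

lemma sum_inverse_square_strict_minimum:
  fixes s x :: "'i \<Rightarrow> real"
  assumes "finite I" and s: "\<And>i. i \<in> I \<Longrightarrow> s i > 0" and x: "\<And>i. i \<in> I \<Longrightarrow> x i > 0"
    and l: "l > 0" and budget: "sum x I \<le> l * sum s I"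
    and "j \<in> I" "x j \<noteq> l * s j"
  shows "(\<Sum>i\<in>I. s i ^ 3 / (l * s i)\<^sup>2) < (\<Sum>i\<in>I. s i ^ 3 / (x i)\<^sup>2)"
proof -
  have "(\<Sum>i\<in>I. s i ^ 3 / (l * s i)\<^sup>2) = (\<Sum>i\<in>I. s i / l\<^sup>2)"
    using s l by (intro sum.cong) (auto simp: field_simps power2_eq_square power3_eq_cube)
  also have "\<dots> = 3 * sum s I / l\<^sup>2 - 2 * (l * sum s I) / l ^ 3"
    using l by (simp add: sum_divide_distrib[symmetric] field_simps power2_eq_square power3_eq_cube)
  \<comment> \<open>The common slope is negative, so only the total \<open>sum x I\<close> matters
    and the budget bounds it from above.\<close>
  also have "\<dots> \<le> 3 * sum s I / l\<^sup>2 - 2 * sum x I / l ^ 3"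
    using budget l by (intro diff_left_mono divide_right_mono mult_left_mono) auto
  also have "\<dots> = (\<Sum>i\<in>I. 3 * s i / l\<^sup>2 - 2 * x i / l ^ 3)"
    by (simp add: sum_subtractf sum_distrib_left sum_divide_distrib)
  also have "\<dots> < (\<Sum>i\<in>I. s i ^ 3 / (x i)\<^sup>2)"
    using assms inverse_square_tangent by (intro sum_strict_mono_ex1) blast+
  finally show ?thesis .
qed

lemma Collect_is_arg_min_eq_singleton:
  fixes f :: "'a \<Rightarrow> 'b :: order"
  assumes "P a" and "\<And>b. P b \<Longrightarrow> b \<noteq> a \<Longrightarrow> f a < f b"
  shows "{b. is_arg_min f P b} = {a}"
  using assms unfolding is_arg_min_def by (auto dest: less_imp_not_less)

theorem proposition1:
  fixes pu c fs bbar :: real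
    and H :: "complex^'u^'n"
  assumes "pu > 0" and "c > 0" and "fs > 0" and "bbar > 0"
  shows "{b :: real^'n. is_arg_min (total_quant_error pu H) (power_feasible c fs bbar) b} =
    {\<chi> i. bbar + log 2 (real CARD('n) * (1 + snr_rf pu H i) powr (1/3) /
        (\<Sum>j\<in>UNIV. (1 + snr_rf pu H j) powr (1/3)))}"
proof -
  \<comment> \<open>The slope of \<open>v / x\<^sup>2\<close> is \<open>- 2 * v / x ^ 3\<close>, so
    equal slopes force \<open>x\<close> proportional to the cube root of the variance
    \<open>v\<close>.\<close>
  define s where "s i = (1 + snr_rf pu H i) powr (1/3)" for i
  define S where "S = sum s UNIV"
  define l where "l = real CARD('n) * 2 powr bbar / S"
  \<comment> \<open>This is \<open>log 2 (l * s i)\<close> in each coordinate, the tangency point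
    translated back to bits.\<close>
  define a :: "real^'n" where "a = (\<chi> i. bbar + log 2 (real CARD('n) * s i / S))"
  define K where "K = pi * sqrt 3 / 2"
  have K: "K > 0"
    by (simp add: K_def)
  have snr: "1 + snr_rf pu H i > 0" for i
    using assms(1) by (simp add: snr_rf_def add_pos_nonneg)
  have s: "s i > 0" for i
    unfolding s_def using snr[of i] by simp
  have s3: "s i ^ 3 = signal_variance pu H i" for i
    using snr[of i] s[of i] powr_realpow[of "s i" 3]
    by (simp add: s_def signal_variance_def powr_powr)
  have S: "S > 0"
    unfolding S_def using s by (intro sum_pos) auto
  have l: "l > 0"
    using S by (simp add: l_def)
  have lS: "l * S = real CARD('n) * 2 powr bbar"
    using S by (simp add: l_def)
  have a: "2 powr (a $ i) = l * s i" for i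
    using s[of i] S by (simp add: a_def l_def powr_add powr_log_cancel)
  have error: "total_quant_error pu H b = K * (\<Sum>i\<in>UNIV. s i ^ 3 / (2 powr (b $ i))\<^sup>2)" for b
    by (simp add: total_quant_error_def quant_error_def s3 K_def sum_distrib_left
        powr_minus_divide powr_power mult.commute)
  \<comment> \<open>The positive factor \<open>c * fs\<close> cancels, and \<open>l * S\<close> is
    the remaining budget.\<close>
  have feasible: "power_feasible c fs bbar b \<longleftrightarrow> (\<Sum>i\<in>UNIV. 2 powr (b $ i)) \<le> l * S" for b :: "real^'n"
  proof -
    have "power_feasible c fs bbar b \<longleftrightarrow> (c * fs) * (\<Sum>i\<in>UNIV. 2 powr (b $ i)) \<le> (c * fs) * (l * S)"
      unfolding power_feasible_def adc_power_def lS by (simp add: sum_distrib_left mult_ac)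
    then show ?thesis
      using assms by simp
  qed
  have "{b. is_arg_min (total_quant_error pu H) (power_feasible c fs bbar) b} = {a}"
  \<comment> \<open>Strict inequality against every other feasible point gives optimality and
    uniqueness at once.\<close>
  proof (rule Collect_is_arg_min_eq_singleton)
    show "power_feasible c fs bbar a"
      by (simp add: feasible a S_def sum_distrib_left)
  next
    fix b assume b: "power_feasible c fs bbar b" "b \<noteq> a"
    then obtain j where "b $ j \<noteq> a $ j"
      by (auto simp: vec_eq_iff)
    then have "2 powr (b $ j) \<noteq> l * s j"
      by (simp add: powr_inj flip: a)
    then have "(\<Sum>i\<in>UNIV. s i ^ 3 / (l * s i)\<^sup>2) < (\<Sum>i\<in>UNIV. s i ^ 3 / (2 powr (b $ i))\<^sup>2)"
      using b(1) s l by (intro sum_inverse_square_strict_minimum) (auto simp: feasible S_def)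
    then show "total_quant_error pu H a < total_quant_error pu H b"
      using K by (simp add: error a)
  qed
  then show ?thesis
    unfolding a_def S_def s_def .
qed

end
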